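(* For all real $t \geq 1$ let $\mathcal{D}(t) := \sum_{n \leq t}\sigma(n) - \frac{t^2 \zeta(2)}{2}$. Then, for all real $x \geq 650$, $$\int_1^{x} \frac{\mathcal{D}(t)}{t^{2}} \, \mathrm{d}t < 0.$$
   Context: $\sigma(n) = \sum_{d \mid n} d$ is the sum-of-divisors function, $\zeta$ is the Riemann zeta function; sums $\sum_{n\le t}$ run over positive integers $n \le t$. *)

theory Defs
  imports "HOL-Analysis.Analysis"
begin

definition sigma_div :: "nat \<Rightarrow> nat" where
  "sigma_div n = (\<Sum>d | d dvd n. d)"

(* The Dirichlet series of the Riemann zeta function. It represents zeta only on the half-line
   s > 1, where it converges; no analytic continuation is provided. *)
definition riemann_zeta :: "real \<Rightarrow> real" where
  "riemann_zeta s = (\<Sum>n. 1 / real (Suc n) powr s)"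

(* The index set is the finite set of positive integers at most t. *)
definition sigma_remainder :: "real \<Rightarrow> real" where
  "sigma_remainder t =
     (\<Sum>n | 1 \<le> n \<and> real n \<le> t. real (sigma_div n)) - t^2 * riemann_zeta 2 / 2"

end

theory Submission
  imports Defs
begin

text \<open>
  Integrating termwise, \<open>\<integral>\<^sub>1\<^sup>x D(t)/t\<^sup>2 dt = (\<Sum>n\<le>x. \<sigma>(n) (1/n - 1/x)) - \<zeta>(2) (x - 1)/2\<close>.
  Writing each divisor \<open>m\<close> of \<open>n\<close> as the cofactor of \<open>d = n/m\<close> turns the sum into
  \<open>\<Sum>d\<le>x. (k/d - k(k+1)/(2x))\<close> with \<open>k = \<lfloor>x/d\<rfloor>\<close>. As a quadratic in a real variable \<open>k\<close>, each
  summand is at most \<open>(x/d - 1/2)\<^sup>2/(2x)\<close>. Expanding the square and using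
  \<open>(\<Sum>d\<le>x. 1/d\<^sup>2) \<le> \<zeta>(2)\<close>, the integral is at most \<open>\<zeta>(2)/2 + 1/8 - H/2\<close> with \<open>H\<close> the harmonic sum
  up to \<open>x\<close>, which is negative already for small \<open>x\<close>.
\<close>

text \<open>The series form bounds the partial sums below; the closed form serves only the final
  numerical estimate.\<close>

lemma riemann_zeta_2_sums: "(\<lambda>n. 1 / real (Suc n) ^ 2) sums riemann_zeta 2"
  and riemann_zeta_2: "riemann_zeta 2 = pi\<^sup>2 / 6"
proof -
  have s: "(\<lambda>n. 1 / real (Suc n) ^ 2) sums (pi\<^sup>2 / 6)"
    using inverse_squares_sums by (simp add: add.commute)
  moreover have "riemann_zeta 2 = (\<Sum>n. 1 / real (Suc n) ^ 2)"
    unfolding riemann_zeta_def by (simp add: powr_numeral del: of_nat_Suc)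
  ultimately show z: "riemann_zeta 2 = pi\<^sup>2 / 6" using sums_unique[OF s] by simp
  show "(\<lambda>n. 1 / real (Suc n) ^ 2) sums riemann_zeta 2" unfolding z by (rule s)
qed

lemma sum_inverse_squares_le: "(\<Sum>d=1..N. 1 / real d ^ 2) \<le> riemann_zeta 2"
proof -
  have "(\<Sum>d=1..N. 1 / real d ^ 2) = (\<Sum>n<N. 1 / real (Suc n) ^ 2)"
    by (rule sum.reindex_bij_witness[of _ Suc "\<lambda>d. d - 1"]) auto
  also have "\<dots> \<le> (\<Sum>n. 1 / real (Suc n) ^ 2)"
    using riemann_zeta_2_sums by (intro sum_le_suminf) (auto simp: sums_iff)
  finally show ?thesis using riemann_zeta_2_sums by (simp add: sums_iff)
qed

text \<open>Both sides run over the pairs with \<open>d * m\<close> \<le> \<open>N\<close>. Taking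
  the divisor \<open>m\<close> itself as inner variable makes the inner sum an arithmetic one, hence
  a quadratic in \<open>N div d\<close>.\<close>

lemma sum_sigma_div_mult:
  fixes c :: "nat \<Rightarrow> real"
  shows "(\<Sum>n=1..N. real (sigma_div n) * c n) = (\<Sum>d=1..N. \<Sum>m=1..N div d. real m * c (d * m))"
proof -
  have "(\<Sum>n=1..N. real (sigma_div n) * c n) = (\<Sum>n=1..N. \<Sum>m | m dvd n. real m * c n)"
    by (simp add: sigma_div_def sum_distrib_right)
  also have "\<dots> = (\<Sum>(n, m)\<in>(SIGMA n:{1..N}. {m. m dvd n}). real m * c n)"
    by (rule sum.Sigma) auto
  also have "\<dots> = (\<Sum>(d, m)\<in>(SIGMA d:{1..N}. {1..N div d}). real m * c (d * m))"
  proof (rule sum.reindex_bij_witness[of _ "\<lambda>(d, m). (d * m, m)" "\<lambda>(n, m). (n div m, m)"], goal_cases)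
    \<comment> \<open>\<open>(n div m, m)\<close> lies in the target index set.\<close>
    case (2 a)
    then obtain m q where a: "a = (m * q, m)" "1 \<le> m * q" "m * q \<le> N"
      by (auto elim!: dvdE)
    then have p: "0 < m" "0 < q" by (auto intro: Nat.gr0I)
    then have "q * 1 \<le> m * q" by simp
    then have "q \<le> N" using a(3) by linarith
    then show ?case using a p by (simp add: less_eq_div_iff_mult_less_eq)
  next
    \<comment> \<open>Conversely, \<open>(d * m, m)\<close> lies in the source index set.\<close>
    case (4 b)
    then obtain d m where b: "b = (d, m)" "0 < d" "0 < m" "m * d \<le> N"
      by (auto simp: less_eq_div_iff_mult_less_eq)
    then show ?case by (simp add: mult.commute)
  qed auto
  also have "\<dots> = (\<Sum>d=1..N. \<Sum>m=1..N div d. real m * c (d * m))"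
    by (rule sum.Sigma[symmetric]) auto
  finally show ?thesis .
qed

lemma sum_linear: "(\<Sum>m=1..k. a - real m * b) = real k * a - real k * (real k + 1) / 2 * b"
  by (induction k) (auto simp: algebra_simps add_divide_distrib)

text \<open>\<open>N\<close> and \<open>x\<close> are independent here: for each \<open>d\<close>
  the slack is a square over \<open>2 * x\<close>, whatever the value of
  \<open>N div d\<close>.\<close>

lemma weighted_sigma_sum_le:
  fixes x :: real
  assumes "x > 0"
  shows "(\<Sum>n=1..N. real (sigma_div n) * (1 / n - 1 / x))
    \<le> x / 2 * (\<Sum>d=1..N. 1 / real d ^ 2) - (\<Sum>d=1..N. 1 / real d) / 2 + N / (8 * x)"
proof -
  have "(\<Sum>n=1..N. real (sigma_div n) * (1 / n - 1 / x))
      = (\<Sum>d=1..N. \<Sum>m=1..N div d. 1 / d - real m * (1 / x))"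
    unfolding sum_sigma_div_mult by (intro sum.cong) (auto simp: field_simps)
  also have "\<dots> \<le> (\<Sum>d=1..N. x / 2 * (1 / real d ^ 2) - 1 / real d / 2 + 1 / (8 * x))"
  proof (rule sum_mono)
    fix d assume "d \<in> {1..N}"
    then have d: "real d > 0" by simp
    define k where "k = real (N div d)"
    \<comment> \<open>Completing the square in \<open>k\<close>: the concave quadratic peaks at
      \<open>k = x / d - 1 / 2\<close>, and the three-term bound is its peak value expanded.\<close>
    have "x / 2 * (1 / real d ^ 2) - 1 / real d / 2 + 1 / (8 * x)
        - (k * (1 / d) - k * (k + 1) / 2 * (1 / x)) = (x / d - 1 / 2 - k)\<^sup>2 / (2 * x)"
      using d assms by (simp add: field_simps power2_eq_square)
    moreover have "0 \<le> (x / d - 1 / 2 - k)\<^sup>2 / (2 * x)" using assms by simp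
    ultimately show "(\<Sum>m=1..N div d. 1 / d - real m * (1 / x))
        \<le> x / 2 * (1 / real d ^ 2) - 1 / real d / 2 + 1 / (8 * x)"
      unfolding sum_linear k_def by linarith
  qed
  also have "\<dots> = x / 2 * (\<Sum>d=1..N. 1 / real d ^ 2) - (\<Sum>d=1..N. 1 / real d) / 2 + N / (8 * x)"
    by (simp add: sum.distrib sum_subtractf sum_distrib_left sum_divide_distrib)
  finally show ?thesis .
qed

lemma has_integral_inverse_square:
  fixes a b :: real
  assumes "0 < a" "a \<le> b"
  shows "((\<lambda>t. 1 / t^2) has_integral (1 / a - 1 / b)) {a..b}"
proof -
  have "((\<lambda>t. 1 / t^2) has_integral (- (1 / b) - - (1 / a))) {a..b}"
    using assms
    by (intro fundamental_theorem_of_calculus)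
       (auto intro!: derivative_eq_intros
         simp: has_real_derivative_iff_has_vector_derivative[symmetric] power2_eq_square)
  then show ?thesis by simp
qed

lemma sigma_remainder_has_integral:
  fixes x :: real
  assumes "x \<ge> 1"
  shows "((\<lambda>t. sigma_remainder t / t^2) has_integral
    ((\<Sum>n=1..nat \<lfloor>x\<rfloor>. real (sigma_div n) * (1 / n - 1 / x)) - riemann_zeta 2 / 2 * (x - 1))) {1..x}"
proof -
  define N where "N = nat \<lfloor>x\<rfloor>"
  have N: "n \<le> N \<longleftrightarrow> real n \<le> x" for n
    unfolding N_def using assms by (simp add: le_nat_floor le_nat_iff le_floor_iff)
  \<comment> \<open>\<open>n\<close> enters the sum in \<open>sigma_remainder t\<close> exactly when
    \<open>t\<close> reaches \<open>n\<close>, so the cutoff turns the varying index set into the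
    fixed \<open>{1..N}\<close>.\<close>
  have "((\<lambda>t. if t \<in> {real n..x} then 1 / t^2 else 0) has_integral (1 / n - 1 / x)) {1..x}"
    if "n \<in> {1..N}" for n
    using that has_integral_inverse_square[of "real n" x]
    by (subst has_integral_restrict) (auto simp: N)
  then have "((\<lambda>t. \<Sum>n=1..N. real (sigma_div n) * (if t \<in> {real n..x} then 1 / t^2 else 0))
      has_integral (\<Sum>n=1..N. real (sigma_div n) * (1 / n - 1 / x))) {1..x}"
    by (intro has_integral_sum has_integral_mult_right) auto
  moreover have "((\<lambda>t. riemann_zeta 2 / 2) has_integral (riemann_zeta 2 / 2 * (x - 1))) {1..x}"
    using has_integral_const_real[of "riemann_zeta 2 / 2" 1 x] assms by (simp add: mult.commute)
  ultimately have "((\<lambda>t. (\<Sum>n=1..N. real (sigma_div n) * (if t \<in> {real n..x} then 1 / t^2 else 0))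
      - riemann_zeta 2 / 2) has_integral
      ((\<Sum>n=1..N. real (sigma_div n) * (1 / n - 1 / x)) - riemann_zeta 2 / 2 * (x - 1))) {1..x}"
    by (rule has_integral_diff)
  moreover have "(\<Sum>n=1..N. real (sigma_div n) * (if t \<in> {real n..x} then 1 / t^2 else 0))
      - riemann_zeta 2 / 2 = sigma_remainder t / t^2" if t: "t \<in> {1..x}" for t
  proof -
    have "(\<Sum>n=1..N. real (sigma_div n) * (if t \<in> {real n..x} then 1 / t^2 else 0))
        = (\<Sum>n\<in>{1..N}. if real n \<le> t then real (sigma_div n) / t^2 else 0)"
      using t by (intro sum.cong) auto
    also have "\<dots> = (\<Sum>n\<in>{n\<in>{1..N}. real n \<le> t}. real (sigma_div n) / t^2)"
      by (rule sum.inter_filter[symmetric]) simp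
    also have "{n\<in>{1..N}. real n \<le> t} = {n. 1 \<le> n \<and> real n \<le> t}"
      using t by (auto simp: N)
    finally show ?thesis
      using t by (simp add: sigma_remainder_def diff_divide_distrib sum_divide_distrib)
  qed
  ultimately show ?thesis
    unfolding N_def[symmetric] by (rule has_integral_eq[rotated])
qed

theorem corollary1p1:
  fixes x :: real
  assumes "x \<ge> 650"
  shows "(\<lambda>t. sigma_remainder t / t^2) integrable_on {1..x} \<and>
         integral {1..x} (\<lambda>t. sigma_remainder t / t^2) < 0"
proof -
  define N where "N = nat \<lfloor>x\<rfloor>"
  \<comment> \<open>Negativity needs a harmonic sum above \<open>riemann_zeta 2 + 1 / 4\<close>. The
    crude \<open>pi < 4\<close> gives \<open>riemann_zeta 2 < 16 / 6\<close>, so exceeding 3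
    suffices, and twelve terms do.\<close>
  have N: "12 \<le> N" "real N \<le> x"
    using assms unfolding N_def by (simp_all add: le_nat_iff le_floor_iff)
  have int: "((\<lambda>t. sigma_remainder t / t^2) has_integral
      ((\<Sum>n=1..N. real (sigma_div n) * (1 / n - 1 / x)) - riemann_zeta 2 / 2 * (x - 1))) {1..x}"
    using sigma_remainder_has_integral[of x] assms by (simp add: N_def)
  have harm_12: "harm 12 > (3 :: real)"
    by (simp add: harm_expand)
  have "x / 2 * (\<Sum>d=1..N. 1 / real d ^ 2) \<le> x / 2 * riemann_zeta 2"
    using assms by (intro mult_left_mono sum_inverse_squares_le) auto
  moreover have "N / (8 * x) \<le> 1 / 8"
    using N assms by (simp add: field_simps)
  moreover have "(\<Sum>d=1..12. 1 / real d) \<le> (\<Sum>d=1..N. 1 / real d)"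
    using N by (intro sum_mono2) auto
  moreover have "(\<Sum>d=1..12. 1 / real d) > 3"
    using harm_12 by (simp add: harm_def inverse_eq_divide)
  moreover have "riemann_zeta 2 < 16 / 6"
    using power_strict_mono[OF pi_less_4, of 2] by (simp add: riemann_zeta_2)
  \<comment> \<open>The part linear in \<open>x\<close> cancels against the bound on the inverse
    squares.\<close>
  moreover have "riemann_zeta 2 / 2 * (x - 1) = x / 2 * riemann_zeta 2 - riemann_zeta 2 / 2"
    by (simp add: field_simps)
  ultimately have "(\<Sum>n=1..N. real (sigma_div n) * (1 / n - 1 / x)) - riemann_zeta 2 / 2 * (x - 1) < 0"
    using weighted_sigma_sum_le[of x N] assms by linarith
  then show ?thesis
    using int by (auto simp: integrable_on_def dest: integral_unique)
qed

end
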